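(* Let $d,N\in\mathbb{N}$, $\Omega\subset\mathbb{R}^d$, $a>0$, and let $X_N\subset\Omega$ be a set of $N$ pairwise distinct points. Then for any $p\in\mathbb{N}$ with $p\geq d(N-1)$ there exists a set $X_{M_p^d}\subset\mathbb{R}^d$ of $M_p^d=\binom{d+p}{d}$ points such that $X_N\subset X_{M_p^d}$ and $X_{M_p^d}$ is $\mathbb{P}_p^d$-unisolvent. In particular, the kernel matrix $\left(k_{a,p}(x_i,x_j)\right)_{i,j=1}^N$ of $k_{a,p}$ on $X_N=\{x_1,\dots,x_N\}$ is invertible if $p\geq d(N-1)$.
   Context: $\mathbb{P}_p^d$ is the space of real polynomials on $\mathbb{R}^d$ of total degree at most $p$; its dimension is $M_p^d=\binom{d+p}{d}$. The polynomial kernel is $k_{a,p}(x,y):=(a+\langle x,y\rangle)^p$ for $x,y\in\mathbb{R}^d$, with $\langle\cdot,\cdot\rangle$ the Euclidean inner product. For a finite-dimensional linear space $U$ of real functions, a set of $\dim(U)$ points $X$ is called $U$-unisolvent if the only $u\in U$ with $u|_X=0$ is $u=0$ (equivalently, for every prescribed set of real values on $X$ there is a unique $u\in U$ attaining them). *)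

theory Defs
  imports "HOL-Analysis.Analysis" "HOL-Library.Function_Algebras"
begin

text \<open>
  Real functions on a type form a real vector space. The library provides pointwise addition
  on the function type, but no scalar multiplication.
\<close>

definition scale_fun :: "real \<Rightarrow> ('b \<Rightarrow> real) \<Rightarrow> 'b \<Rightarrow> real"
  where "scale_fun c f = (\<lambda>x. c * f x)"

interpretation real_fun: vector_space "scale_fun :: real \<Rightarrow> ('b \<Rightarrow> real) \<Rightarrow> 'b \<Rightarrow> real"
  by unfold_locales (auto simp: scale_fun_def fun_eq_iff algebra_simps)

definition monomial_fun :: "('d::finite \<Rightarrow> nat) \<Rightarrow> real ^ 'd \<Rightarrow> real"
  where "monomial_fun \<alpha> = (\<lambda>x. \<Prod>i\<in>UNIV. (x $ i) ^ \<alpha> i)"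

definition poly_space :: "nat \<Rightarrow> (real ^ 'd::finite \<Rightarrow> real) set"
  where "poly_space p = real_fun.span {monomial_fun \<alpha> | \<alpha>. (\<Sum>i\<in>UNIV. \<alpha> i) \<le> p}"

text \<open>
  Finiteness of the point set is explicit because \<^const>\<open>card\<close> is 0 on infinite sets.
  The notion is meant for finite-dimensional linear spaces \<open>U\<close>.
\<close>

definition unisolvent :: "('b \<Rightarrow> real) set \<Rightarrow> 'b set \<Rightarrow> bool"
  where "unisolvent U X \<longleftrightarrow>
    finite X \<and> card X = real_fun.dim U \<and> (\<forall>u\<in>U. (\<forall>x\<in>X. u x = 0) \<longrightarrow> u = (\<lambda>_. 0))"

definition poly_kernel :: "real \<Rightarrow> nat \<Rightarrow> real ^ 'd::finite \<Rightarrow> real ^ 'd \<Rightarrow> real"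
  where "poly_kernel a p x y = (a + x \<bullet> y) ^ p"

definition kernel_matrix ::
  "('b \<Rightarrow> 'b \<Rightarrow> real) \<Rightarrow> ('n::finite \<Rightarrow> 'b) \<Rightarrow> real ^ 'n ^ 'n"
  where "kernel_matrix k x = (\<chi> i j. k (x i) (x j))"

end

theory Submission
  imports Defs
begin

text \<open>
  Both claims rest on Lagrange functions of low degree. If \<open>x\<^sub>1, \<dots>, x\<^sub>N\<close> are distinct points, then
  \<open>\<Prod>\<^bsub>i\<noteq>j\<^esub> \<langle>\<cdot> - x\<^sub>i, x\<^sub>j - x\<^sub>i\<rangle>\<close> is a product of \<open>N - 1\<close> affine functions, so it lies in
  the space \<open>\<P>\<^sub>p\<close> of polynomials of degree at most \<open>p\<close>, because \<open>N - 1 \<le> d(N - 1) \<le> p\<close>.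
  It vanishes at every \<open>x\<^sub>i\<close> with \<open>i \<noteq> j\<close>, and at \<open>x\<^sub>j\<close> it is a product of positive numbers. After normalisation these products are Lagrange
  functions in \<open>\<P>\<^sub>p\<close> for the given points (lemma \<open>nodal_poly_space\<close>).

  Lagrange functions are linearly independent. In a finite-dimensional space the number of points
  admitting them is therefore bounded, and there is a largest such set \<open>Y\<close> containing the given
  points. If some \<open>u \<noteq> 0\<close> in the space vanished on \<open>Y\<close>, then any point at which \<open>u\<close> does not
  vanish could be added to \<open>Y\<close>. So there is no such \<open>u\<close>, the Lagrange functions of \<open>Y\<close> form a
  basis, and \<open>Y\<close> is unisolvent (lemma \<open>nodal_extends_to_unisolvent\<close>).

  For the dimension of \<open>\<P>\<^sub>p\<close>, the monomials of degree at most \<open>p\<close> give the upper bound. The lower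
  bound comes from the Newton polynomials \<open>\<Prod>\<^sub>i x\<^sub>i (x\<^sub>i - 1) \<cdots> (x\<^sub>i - \<alpha>\<^sub>i + 1)\<close>, whose values at the
  points of \<open>\<nat>\<^sup>d\<close> form a triangular matrix (lemma \<open>dim_poly_space\<close>).

  For the kernel matrix, let \<open>Q\<^sub>p(c) = \<Sum>\<^bsub>i,j\<^esub> c\<^sub>i c\<^sub>j (a + \<langle>x\<^sub>i, x\<^sub>j\<rangle>)\<^sup>p\<close>. Splitting off one factor of
  the power gives
  \<open>Q\<^bsub>p+1\<^esub>(c) = a Q\<^sub>p(c) + \<Sum>\<^sub>k Q\<^sub>p(c\<^sup>k)\<close>, where \<open>k\<close> runs over the coordinates and \<open>c\<^sup>k\<close> has the
  entries \<open>c\<^sub>i (x\<^sub>i)\<^sub>k\<close>. By induction on \<open>p\<close>, the form is nonnegative, and \<open>Q\<^sub>p(c) = 0\<close> forces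
  \<open>\<Sum>\<^sub>i c\<^sub>i u(x\<^sub>i) = 0\<close> for each monomial \<open>u\<close> of degree at most \<open>p\<close>, hence for each \<open>u \<in> \<P>\<^sub>p\<close>.
  Taking the Lagrange functions for \<open>u\<close> gives \<open>c = 0\<close>.
\<close>

section \<open>Independence of function families and Lagrange functions\<close>

lemma sum_fun_apply: "(\<Sum>i\<in>A. f i) x = (\<Sum>i\<in>A. f i x)"
  for f :: "'i \<Rightarrow> 'b \<Rightarrow> real"
  by (induction A rule: infinite_finite_induct) auto

text \<open>
  The rank \<open>r\<close> makes the matrix of the values \<open>f \<beta> (z \<alpha>)\<close> triangular with nonzero diagonal. In a
  vanishing combination, evaluation at \<open>z \<alpha>\<close> for an index \<open>\<alpha>\<close> of minimal rank among those with
  nonzero coefficient isolates that coefficient.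
\<close>

lemma triangular_family_independent:
  fixes f :: "'i \<Rightarrow> 'b \<Rightarrow> real" and r :: "'i \<Rightarrow> nat"
  assumes fin: "finite A"
    and diag: "\<And>\<alpha>. \<alpha> \<in> A \<Longrightarrow> f \<alpha> (z \<alpha>) \<noteq> 0"
    and upper: "\<And>\<alpha> \<beta>. \<lbrakk>\<alpha> \<in> A; \<beta> \<in> A; \<beta> \<noteq> \<alpha>; r \<alpha> \<le> r \<beta>\<rbrakk> \<Longrightarrow> f \<beta> (z \<alpha>) = 0"
  shows "inj_on f A" and "\<not> real_fun.dependent (f ` A)"
proof -
  show inj: "inj_on f A"
    by (metis (no_types, opaque_lifting) diag inj_onI nle_le upper)
  show "\<not> real_fun.dependent (f ` A)"
  proof
    assume "real_fun.dependent (f ` A)"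
    then obtain u where u: "\<exists>v\<in>f ` A. u v \<noteq> 0" "(\<Sum>v\<in>f ` A. scale_fun (u v) v) = 0"
      using real_fun.dependent_finite[of "f ` A"] fin by blast
    obtain \<alpha> where \<alpha>: "\<alpha> \<in> A" "u (f \<alpha>) \<noteq> 0"
      and min: "\<And>\<beta>. \<beta> \<in> A \<Longrightarrow> u (f \<beta>) \<noteq> 0 \<Longrightarrow> r \<alpha> \<le> r \<beta>"
      using u(1) ex_has_least_nat[of "\<lambda>\<alpha>. \<alpha> \<in> A \<and> u (f \<alpha>) \<noteq> 0" _ r] by (metis imageE)
    have "0 = (\<Sum>\<beta>\<in>A. scale_fun (u (f \<beta>)) (f \<beta>)) (z \<alpha>)"
      using u(2) by (simp add: sum.reindex[OF inj])
    also have "\<dots> = (\<Sum>\<beta>\<in>A. u (f \<beta>) * f \<beta> (z \<alpha>))"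
      by (simp add: sum_fun_apply scale_fun_def)
    also have "\<dots> = (\<Sum>\<beta>\<in>A. if \<beta> = \<alpha> then u (f \<alpha>) * f \<alpha> (z \<alpha>) else 0)"
      by (rule sum.cong) (use \<alpha> min upper in auto)
    also have "\<dots> = u (f \<alpha>) * f \<alpha> (z \<alpha>)"
      using fin \<alpha> by simp
    finally show False using \<alpha> diag by simp
  qed
qed

text \<open>
  The functions \<open>l x\<close> are the Lagrange functions of the points. For a linear space \<open>U\<close> and a finite
  set \<open>X\<close> their existence means that arbitrary values on \<open>X\<close> are attained by functions of \<open>U\<close>.
\<close>

definition nodal :: "('b \<Rightarrow> real) set \<Rightarrow> 'b set \<Rightarrow> bool"
  where "nodal U X \<longleftrightarrow> (\<exists>l. \<forall>x\<in>X. l x \<in> U \<and> (\<forall>y\<in>X. l x y = of_bool (y = x)))"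

text \<open>
  Scaled to the value \<open>1\<close> at \<open>y\<close>, the function \<open>u\<close> becomes the Lagrange function of the new point.
  Subtracting multiples of it makes the old ones vanish at \<open>y\<close> and leaves their values on \<open>X\<close>
  unchanged.
\<close>

lemma nodal_insert:
  assumes U: "real_fun.subspace U" and X: "nodal U X"
    and u: "u \<in> U" "\<And>x. x \<in> X \<Longrightarrow> u x = 0" "u y \<noteq> 0"
  shows "nodal U (insert y X)"
proof -
  obtain l where l: "\<And>x. x \<in> X \<Longrightarrow> l x \<in> U"
      "\<And>x x'. x \<in> X \<Longrightarrow> x' \<in> X \<Longrightarrow> l x x' = of_bool (x' = x)"
    using X unfolding nodal_def by blast
  have y: "y \<notin> X" using u by blast
  define v where "v = scale_fun (1 / u y) u"
  have v: "v \<in> U" "v y = 1" "\<And>x. x \<in> X \<Longrightarrow> v x = 0"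
    unfolding v_def using u(2,3) by (auto intro: real_fun.subspace_scale[OF U u(1)])
      (simp_all add: scale_fun_def)
  define l' where "l' x = (if x = y then v else l x - scale_fun (l x y) v)" for x
  have "l' x \<in> U \<and> (\<forall>x'\<in>insert y X. l' x x' = of_bool (x' = x))" if "x \<in> insert y X" for x
  proof (cases "x = y")
    case True
    then show ?thesis using v y by (auto simp: l'_def)
  next
    case False
    then have "x \<in> X" using that by simp
    then have "l' x \<in> U"
      using False l(1) v(1) U
      by (simp add: l'_def real_fun.subspace_diff real_fun.subspace_scale)
    then show ?thesis
      using False \<open>x \<in> X\<close> l(2) v y by (auto simp: l'_def scale_fun_def)
  qed
  then show ?thesis unfolding nodal_def by blast
qed

lemma nodal_extends_to_unisolvent:
  assumes U: "real_fun.subspace U" and fin: "finite B" and B: "U \<subseteq> real_fun.span B"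
    and X: "finite X" "nodal U X"
  obtains Y where "X \<subseteq> Y" "unisolvent U Y"
proof -
  define P where "P Y \<longleftrightarrow> finite Y \<and> nodal U Y \<and> X \<subseteq> Y" for Y
  have indep: "inj_on l Y" "\<not> real_fun.dependent (l ` Y)"
    if "finite Y" "\<forall>x\<in>Y. l x \<in> U \<and> (\<forall>y\<in>Y. l x y = of_bool (y = x))" for Y l
    using triangular_family_independent[of Y l "\<lambda>y. y" "\<lambda>_. 0"] that by auto
  have "card Y < Suc (card B)" if PY: "P Y" for Y
  proof -
    obtain l where l: "\<forall>x\<in>Y. l x \<in> U \<and> (\<forall>y\<in>Y. l x y = of_bool (y = x))"
      using PY unfolding P_def nodal_def by blast
    have "finite Y" using PY by (simp add: P_def)
    note i = indep[OF this l]
    have "l ` Y \<subseteq> real_fun.span B" using l B by blast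
    then have "card (l ` Y) \<le> card B"
      using real_fun.independent_span_bound[OF fin i(2)] by blast
    then show ?thesis using i(1) by (simp add: card_image)
  qed
  moreover have "P X" using X by (simp add: P_def)
  ultimately obtain Y where Y: "P Y" and max: "\<And>Z. P Z \<Longrightarrow> card Z \<le> card Y"
    using ex_has_greatest_nat[of P X card "Suc (card B)"] by blast
  have finY: "finite Y" and nodY: "nodal U Y" and XY: "X \<subseteq> Y" using Y by (auto simp: P_def)
  \<comment> \<open>A nonzero function vanishing on \<open>Y\<close> would allow a further point, against maximality.\<close>
  have zero: "u = (\<lambda>_. 0)" if "u \<in> U" "\<forall>x\<in>Y. u x = 0" for u
  proof (rule ccontr)
    assume "u \<noteq> (\<lambda>_. 0)"
    then obtain y where y: "u y \<noteq> 0" by auto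
    then have "P (insert y Y)"
      using nodal_insert[OF U nodY \<open>u \<in> U\<close>] that finY XY by (auto simp: P_def)
    from max[OF this] finY that y show False by (auto simp: card_insert_if split: if_splits)
  qed
  obtain l where l: "\<forall>x\<in>Y. l x \<in> U \<and> (\<forall>y\<in>Y. l x y = of_bool (y = x))"
    using nodY unfolding nodal_def by blast
  note i = indep[OF finY l]
  \<comment> \<open>A function and its interpolant \<open>?w\<close> agree on \<open>Y\<close>, so they are equal.\<close>
  have "u \<in> real_fun.span (l ` Y)" if "u \<in> U" for u
  proof -
    let ?w = "\<Sum>x\<in>Y. scale_fun (u x) (l x)"
    have "?w \<in> U"
      using l U by (auto intro!: real_fun.subspace_sum real_fun.subspace_scale)
    then have "u - ?w \<in> U" using that U by (simp add: real_fun.subspace_diff)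
    moreover have "(u - ?w) y = 0" if "y \<in> Y" for y
    proof -
      have "?w y = (\<Sum>x\<in>Y. if x = y then u x else 0)"
        unfolding sum_fun_apply scale_fun_def by (rule sum.cong) (use l that in auto)
      then show ?thesis using finY that by simp
    qed
    ultimately have "u - ?w = (\<lambda>_. 0)" using zero by blast
    then have "u = ?w" by (simp only: zero_fun_def[symmetric] right_minus_eq)
    also have "?w \<in> real_fun.span (l ` Y)"
      by (intro real_fun.span_sum real_fun.span_scale real_fun.span_base imageI)
    finally show ?thesis .
  qed
  moreover have "l ` Y \<subseteq> U" using l by blast
  ultimately have "card (l ` Y) = real_fun.dim U"
    using i(2) by (intro real_fun.basis_card_eq_dim) auto
  then have "unisolvent U Y"
    using finY zero i(1) by (auto simp: unisolvent_def card_image)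
  with XY show thesis using that by blast
qed

section \<open>Polynomial spaces\<close>

lemma subspace_poly_space: "real_fun.subspace (poly_space p)"
  unfolding poly_space_def by (rule real_fun.subspace_span)

lemma monomial_in_poly_space: "sum \<alpha> UNIV \<le> p \<Longrightarrow> monomial_fun \<alpha> \<in> poly_space p"
  unfolding poly_space_def by (rule real_fun.span_base) blast

lemma poly_space_mono: "p \<le> q \<Longrightarrow> poly_space p \<subseteq> poly_space q"
  unfolding poly_space_def by (rule real_fun.span_mono) (use order_trans in blast)

lemma monomial_fun_mult:
  "(\<lambda>x. monomial_fun \<alpha> x * monomial_fun \<beta> x) = monomial_fun (\<lambda>i. \<alpha> i + \<beta> i)"
  by (simp add: monomial_fun_def power_add prod.distrib)

lemma poly_space_induct [consumes 1, case_names zero add]: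
  assumes "u \<in> poly_space p" and "P 0"
    and "\<And>c \<alpha> v. \<lbrakk>sum \<alpha> UNIV \<le> p; P v\<rbrakk> \<Longrightarrow> P (scale_fun c (monomial_fun \<alpha>) + v)"
  shows "P u"
  using assms(1) unfolding poly_space_def
proof (induction rule: real_fun.span_induct_alt)
  case base
  then show ?case by (rule assms(2))
next
  case (step c x y)
  then show ?case using assms(3) by blast
qed

lemma poly_space_mult:
  assumes u: "u \<in> poly_space m" and v: "v \<in> poly_space n"
  shows "(\<lambda>x. u x * v x) \<in> poly_space (m + n)"
  using u
proof (induction u rule: poly_space_induct)
  case zero
  then show ?case using real_fun.subspace_0[OF subspace_poly_space] by (simp add: zero_fun_def)
next
  case (add c \<alpha> w)
  have "(\<lambda>x. monomial_fun \<alpha> x * v x) \<in> poly_space (m + n)"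
    using v
  proof (induction v rule: poly_space_induct)
    case zero
    then show ?case using real_fun.subspace_0[OF subspace_poly_space] by (simp add: zero_fun_def)
  next
    case (add b \<beta> v)
    have eq: "(\<lambda>x. monomial_fun \<alpha> x * (scale_fun b (monomial_fun \<beta>) + v) x)
        = scale_fun b (monomial_fun (\<lambda>i. \<alpha> i + \<beta> i)) + (\<lambda>x. monomial_fun \<alpha> x * v x)"
      unfolding monomial_fun_mult[symmetric] by (auto simp: scale_fun_def algebra_simps)
    have "sum (\<lambda>i. \<alpha> i + \<beta> i) UNIV \<le> m + n"
      using add \<open>sum \<alpha> UNIV \<le> m\<close> by (simp add: sum.distrib)
    then show ?case
      unfolding eq using add
      by (intro real_fun.subspace_add real_fun.subspace_scale subspace_poly_space
          monomial_in_poly_space)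
  qed
  moreover have "(\<lambda>x. (scale_fun c (monomial_fun \<alpha>) + w) x * v x)
      = scale_fun c (\<lambda>x. monomial_fun \<alpha> x * v x) + (\<lambda>x. w x * v x)"
    by (auto simp: scale_fun_def algebra_simps)
  ultimately show ?case
    using add by (simp add: real_fun.subspace_add real_fun.subspace_scale subspace_poly_space)
qed

lemma const_in_poly_space: "(\<lambda>_. c) \<in> poly_space p"
proof -
  have "scale_fun c (monomial_fun (\<lambda>_. 0)) \<in> poly_space p"
    by (intro real_fun.subspace_scale subspace_poly_space monomial_in_poly_space) simp
  then show ?thesis by (simp add: monomial_fun_def scale_fun_def)
qed

lemma monomial_fun_unit:
  fixes i :: "'d::finite"
  shows "monomial_fun (\<lambda>j. of_bool (j = i)) = (\<lambda>x. x $ i)"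
proof
  fix x :: "real ^ 'd"
  have "monomial_fun (\<lambda>j. of_bool (j = i)) x = (\<Prod>j\<in>UNIV. if j = i then x $ i else 1)"
    unfolding monomial_fun_def by (rule prod.cong) auto
  then show "monomial_fun (\<lambda>j. of_bool (j = i)) x = x $ i" by simp
qed

lemma coordinate_in_poly_space: "(\<lambda>x. x $ i) \<in> poly_space 1"
  unfolding monomial_fun_unit[symmetric] by (rule monomial_in_poly_space) (simp add: of_bool_def)

lemma coordinate_minus_in_poly_space: "(\<lambda>x. x $ i - c) \<in> poly_space 1"
  using real_fun.subspace_diff[OF subspace_poly_space coordinate_in_poly_space const_in_poly_space]
  by (simp add: fun_diff_def)

lemma inner_diff_in_poly_space: "(\<lambda>x. (x - b) \<bullet> w) \<in> poly_space 1"
proof -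
  have eq: "(\<lambda>x. (x - b) \<bullet> w) = (\<Sum>i\<in>UNIV. scale_fun (w $ i) (\<lambda>x. x $ i - b $ i))"
    by (auto simp: fun_eq_iff sum_fun_apply scale_fun_def inner_vec_def mult.commute)
  show ?thesis
    unfolding eq
    by (intro real_fun.subspace_sum real_fun.subspace_scale subspace_poly_space
        coordinate_minus_in_poly_space)
qed

lemma poly_space_prod:
  assumes "\<And>i. i \<in> I \<Longrightarrow> f i \<in> poly_space (n i)"
  shows "(\<lambda>x. \<Prod>i\<in>I. f i x) \<in> poly_space (\<Sum>i\<in>I. n i)"
  using assms
proof (induction I rule: infinite_finite_induct)
  case (insert i I)
  then show ?case using poly_space_mult[of "f i" "n i"] by simp
qed (simp_all add: const_in_poly_space)

section \<open>The dimension of the polynomial space\<close>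

text \<open>
  Induction on \<open>S\<close>: fixing the exponent \<open>k\<close> of a new variable leaves degree at most \<open>p - k\<close> for the
  others, and the resulting binomial coefficients are summed along a diagonal of Pascal's triangle.
\<close>

lemma card_exponents_on:
  assumes "finite S"
  shows "finite {\<alpha> :: 'i \<Rightarrow> nat. (\<forall>i. i \<notin> S \<longrightarrow> \<alpha> i = 0) \<and> sum \<alpha> S \<le> p} \<and>
    card {\<alpha> :: 'i \<Rightarrow> nat. (\<forall>i. i \<notin> S \<longrightarrow> \<alpha> i = 0) \<and> sum \<alpha> S \<le> p} = (card S + p) choose card S"
    (is "finite (?T S p) \<and> card (?T S p) = _")
  using assms
proof (induction S arbitrary: p rule: finite_induct)
  case empty
  have "?T {} p = {\<lambda>_. 0}" by auto
  then show ?case by simp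
next
  case (insert i S)
  let ?D = "SIGMA k:{..p}. ?T S (p - k)"
  have upd: "(\<Sum>j\<in>S. if j = i then k else \<alpha> j) = sum \<alpha> S" for \<alpha> :: "'i \<Rightarrow> nat" and k
    by (rule sum.cong) (use insert in auto)
  have bij: "bij_betw (\<lambda>(k, \<alpha>). \<alpha>(i := k)) ?D (?T (insert i S) p)"
  proof (rule bij_betw_byWitness[where f' = "\<lambda>\<alpha>. (\<alpha> i, \<alpha>(i := 0))"])
    show "\<forall>a\<in>?D. (\<lambda>\<alpha>. (\<alpha> i, \<alpha>(i := 0))) (case a of (k, \<alpha>) \<Rightarrow> \<alpha>(i := k)) = a"
      using insert by (auto simp: fun_eq_iff)
    show "\<forall>\<alpha>\<in>?T (insert i S) p. (case (\<alpha> i, \<alpha>(i := 0)) of (k, \<alpha>) \<Rightarrow> \<alpha>(i := k)) = \<alpha>"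
      by auto
    show "(\<lambda>(k, \<alpha>). \<alpha>(i := k)) ` ?D \<subseteq> ?T (insert i S) p"
      using insert by (auto simp: upd)
    show "(\<lambda>\<alpha>. (\<alpha> i, \<alpha>(i := 0))) ` ?T (insert i S) p \<subseteq> ?D"
      using insert by (auto simp: upd)
  qed
  have fin: "finite ?D" using insert by auto
  have "card (?T (insert i S) p) = card ?D"
    using bij_betw_same_card[OF bij] by simp
  also have "\<dots> = (\<Sum>k\<le>p. (card S + (p - k)) choose card S)"
    using insert by (simp add: card_SigmaI)
  also have "\<dots> = (\<Sum>k\<le>p. (card S + k) choose card S)"
    by (rule sum.reindex_bij_witness[of _ "\<lambda>k. p - k" "\<lambda>k. p - k"]) auto
  also have "\<dots> = (card S + p + 1) choose (card S + 1)"
    by (rule choose_rising_sum(1))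
  finally show ?case
    using insert bij_betw_finite[OF bij] fin by simp
qed

lemma card_exponents:
  "finite {\<alpha> :: 'd::finite \<Rightarrow> nat. sum \<alpha> UNIV \<le> p}"
  "card {\<alpha> :: 'd::finite \<Rightarrow> nat. sum \<alpha> UNIV \<le> p} = (CARD('d) + p) choose CARD('d)"
  using card_exponents_on[of "UNIV :: 'd set" p] by auto

definition newton_fun :: "('d::finite \<Rightarrow> nat) \<Rightarrow> real ^ 'd \<Rightarrow> real"
  where "newton_fun \<alpha> = (\<lambda>x. \<Prod>i\<in>UNIV. \<Prod>m<\<alpha> i. (x $ i - real m))"

lemma newton_fun_in_poly_space:
  assumes "sum \<alpha> UNIV \<le> p"
  shows "newton_fun \<alpha> \<in> poly_space p"
proof -
  have "(\<lambda>x. \<Prod>m<\<alpha> i. (x $ i - real m)) \<in> poly_space (\<alpha> i)" for i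
    using poly_space_prod[of "{..<\<alpha> i}" "\<lambda>m x. x $ i - real m" "\<lambda>_. 1",
        OF coordinate_minus_in_poly_space] by simp
  then have "newton_fun \<alpha> \<in> poly_space (sum \<alpha> UNIV)"
    unfolding newton_fun_def by (intro poly_space_prod)
  then show ?thesis using poly_space_mono[OF assms] by blast
qed

text \<open>
  Unless \<open>\<beta> \<le> \<alpha>\<close> in every coordinate, a factor of \<open>newton_fun \<beta>\<close> is zero at the lattice point
  \<open>\<alpha>\<close>; and \<open>\<beta> \<le> \<alpha>\<close> together with \<open>\<beta> \<noteq> \<alpha>\<close> makes the degree of \<open>\<beta>\<close> smaller. So the values are
  triangular with respect to the degree.
\<close>

lemma newton_fun_eq_0:
  assumes "\<beta> \<noteq> \<alpha>" and "sum \<alpha> UNIV \<le> sum \<beta> UNIV"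
  shows "newton_fun \<beta> (\<chi> i. real (\<alpha> i)) = 0"
proof -
  have "\<exists>i. \<alpha> i < \<beta> i"
  proof (rule ccontr)
    assume "\<not> ?thesis"
    then have le: "\<beta> i \<le> \<alpha> i" for i by (simp add: not_less)
    moreover obtain j where "\<beta> j \<noteq> \<alpha> j" using assms(1) by auto
    ultimately have "sum \<beta> UNIV < sum \<alpha> UNIV"
      by (intro sum_strict_mono_ex1) (auto simp: less_le)
    with assms(2) show False by simp
  qed
  then obtain i where "\<alpha> i < \<beta> i" by blast
  then have "(\<Prod>m<\<beta> i. (real (\<alpha> i) - real m)) = 0" by auto
  then show ?thesis by (auto simp: newton_fun_def)
qed

lemma newton_fun_nonzero: "newton_fun \<alpha> (\<chi> i. real (\<alpha> i)) \<noteq> 0"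
  by (auto simp: newton_fun_def)

lemma finite_monomials:
  "finite {monomial_fun \<alpha> | \<alpha> :: 'd::finite \<Rightarrow> nat. sum \<alpha> UNIV \<le> p}"
  unfolding setcompr_eq_image by (intro finite_imageI card_exponents(1))

lemma dim_poly_space:
  "real_fun.dim (poly_space p :: (real ^ 'd::finite \<Rightarrow> real) set) = (CARD('d) + p) choose CARD('d)"
proof -
  let ?A = "{\<alpha> :: 'd \<Rightarrow> nat. sum \<alpha> UNIV \<le> p}"
  let ?U = "poly_space p :: (real ^ 'd \<Rightarrow> real) set"
  let ?N = "newton_fun ` ?A"
  have inj: "inj_on newton_fun ?A" and indep: "\<not> real_fun.dependent ?N"
    by (rule triangular_family_independent[where z = "\<lambda>\<alpha>. \<chi> i. real (\<alpha> i)"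
          and r = "\<lambda>\<alpha>. sum \<alpha> UNIV"];
        simp add: card_exponents(1) newton_fun_nonzero newton_fun_eq_0)+
  obtain B where B: "B \<subseteq> ?U" "\<not> real_fun.dependent B" "?U \<subseteq> real_fun.span B"
      "card B = real_fun.dim ?U"
    using real_fun.basis_exists by blast
  have span: "?U = real_fun.span (monomial_fun ` ?A)"
    by (simp add: poly_space_def setcompr_eq_image)
  have le: "finite B \<and> card B \<le> card (monomial_fun ` ?A)"
    by (rule real_fun.independent_span_bound[OF finite_imageI[OF card_exponents(1)] B(2)])
      (use B(1) in \<open>simp add: span\<close>)
  moreover have "card (monomial_fun ` ?A) \<le> card ?A"
    using card_exponents(1) by (rule card_image_le)
  moreover have "?N \<subseteq> real_fun.span B"
    using newton_fun_in_poly_space B(3) by blast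
  then have "card ?N \<le> card B"
    using real_fun.independent_span_bound[OF _ indep] le by blast
  ultimately have "card B = card ?A"
    using card_image[OF inj] by linarith
  then show ?thesis using B(4) card_exponents(2) by metis
qed

section \<open>Lagrange functions for few points\<close>

text \<open>
  The factor belonging to \<open>z\<close> vanishes on the hyperplane through \<open>z\<close> orthogonal to \<open>x - z\<close>, and
  \<open>x\<close> is not on it, since the factor has the value \<open>\<parallel>x - z\<parallel>\<^sup>2\<close> there.
\<close>

lemma nodal_poly_space:
  fixes X :: "(real ^ 'd::finite) set"
  assumes fin: "finite X" and p: "card X - 1 \<le> p"
  shows "nodal (poly_space p) X"
proof -
  define g where "g x y = (\<Prod>z\<in>X - {x}. (y - z) \<bullet> (x - z))" for x y :: "real ^ 'd"
  have g: "g x \<in> poly_space p" if "x \<in> X" for x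
  proof -
    have "g x \<in> poly_space (\<Sum>z\<in>X - {x}. 1)"
      unfolding g_def by (intro poly_space_prod inner_diff_in_poly_space)
    then show ?thesis using that fin p poly_space_mono[OF p] by auto
  qed
  have gx: "g x x \<noteq> 0" for x using fin by (simp add: g_def)
  have g0: "g x y = 0" if "y \<in> X" "y \<noteq> x" for x y
    unfolding g_def using fin that by (intro prod_zero bexI[of _ y]) auto
  have "scale_fun (1 / g x x) (g x) \<in> poly_space p \<and>
      (\<forall>y\<in>X. scale_fun (1 / g x x) (g x) y = of_bool (y = x))" if "x \<in> X" for x
  proof
    show "scale_fun (1 / g x x) (g x) \<in> poly_space p"
      by (rule real_fun.subspace_scale[OF subspace_poly_space g[OF that]])
    show "\<forall>y\<in>X. scale_fun (1 / g x x) (g x) y = of_bool (y = x)"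
      using gx g0 by (auto simp: scale_fun_def)
  qed
  then show ?thesis
    unfolding nodal_def by (intro exI[of _ "\<lambda>x. scale_fun (1 / g x x) (g x)"]) blast
qed

section \<open>The kernel matrix\<close>

definition kernel_form ::
  "real \<Rightarrow> nat \<Rightarrow> ('n::finite \<Rightarrow> real ^ 'd::finite) \<Rightarrow> ('n \<Rightarrow> real) \<Rightarrow> real"
  where "kernel_form a p x c = (\<Sum>i\<in>UNIV. \<Sum>j\<in>UNIV. c i * c j * poly_kernel a p (x i) (x j))"

lemma kernel_form_0: "kernel_form a 0 x c = (\<Sum>i\<in>UNIV. c i)\<^sup>2"
  by (simp add: kernel_form_def poly_kernel_def power2_eq_square sum_product)

lemma kernel_form_Suc:
  "kernel_form a (Suc p) x c
    = a * kernel_form a p x c + (\<Sum>k\<in>UNIV. kernel_form a p x (\<lambda>i. c i * x i $ k))"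
proof -
  let ?K = "\<lambda>i j. poly_kernel a p (x i) (x j)"
  have "kernel_form a (Suc p) x c = (\<Sum>i\<in>UNIV. \<Sum>j\<in>UNIV.
      a * (c i * c j * ?K i j) + (\<Sum>k\<in>UNIV. c i * x i $ k * (c j * x j $ k) * ?K i j))"
    unfolding kernel_form_def poly_kernel_def
    by (intro sum.cong refl)
      (simp add: inner_vec_def algebra_simps sum_distrib_left sum_distrib_right)
  also have "\<dots> = a * kernel_form a p x c +
      (\<Sum>i\<in>UNIV. \<Sum>j\<in>UNIV. \<Sum>k\<in>UNIV. c i * x i $ k * (c j * x j $ k) * ?K i j)"
    by (simp add: kernel_form_def sum.distrib sum_distrib_left)
  also have "(\<Sum>i\<in>UNIV. \<Sum>j\<in>UNIV. \<Sum>k\<in>UNIV. c i * x i $ k * (c j * x j $ k) * ?K i j)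
      = (\<Sum>i\<in>UNIV. \<Sum>k\<in>UNIV. \<Sum>j\<in>UNIV. c i * x i $ k * (c j * x j $ k) * ?K i j)"
    by (intro sum.cong refl sum.swap)
  also have "\<dots> = (\<Sum>k\<in>UNIV. kernel_form a p x (\<lambda>i. c i * x i $ k))"
    unfolding kernel_form_def by (rule sum.swap)
  finally show ?thesis .
qed

lemma kernel_form_nonneg: "a > 0 \<Longrightarrow> kernel_form a p x c \<ge> 0"
  by (induction p arbitrary: c) (auto simp: kernel_form_0 kernel_form_Suc
      intro!: add_nonneg_nonneg sum_nonneg)

text \<open>
  All summands in the recursion for the form are nonnegative, so they vanish together with their sum.
  The term \<open>a Q\<^sub>p(c)\<close> takes care of the monomials of degree at most \<open>p\<close>. A monomial of degree
  \<open>p + 1\<close> contains some variable, say the \<open>k\<close>-th; moving one such factor into the coefficients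
  leads to the term \<open>Q\<^sub>p(c\<^sup>k)\<close>, where \<open>c\<^sup>k\<close> has the entries \<open>c\<^sub>i (x\<^sub>i)\<^sub>k\<close>.
\<close>

lemma kernel_form_eq_0_monomial:
  fixes x :: "'n::finite \<Rightarrow> real ^ 'd::finite"
  assumes "a > 0" and "kernel_form a p x c = 0" and "sum \<alpha> UNIV \<le> p"
  shows "(\<Sum>i\<in>UNIV. c i * monomial_fun \<alpha> (x i)) = 0"
  using assms(2,3)
proof (induction p arbitrary: c \<alpha>)
  case 0
  then have "monomial_fun \<alpha> = (\<lambda>_. 1)" by (simp add: monomial_fun_def)
  then show ?case using \<open>kernel_form a 0 x c = 0\<close> by (simp only: kernel_form_0) simp
next
  case (Suc p)
  let ?S = "\<Sum>k\<in>UNIV. kernel_form a p x (\<lambda>i. c i * x i $ k)"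
  have nonneg: "a * kernel_form a p x c \<ge> 0" "?S \<ge> 0"
    using \<open>a > 0\<close> by (auto simp: kernel_form_nonneg intro!: sum_nonneg)
  then have zero: "kernel_form a p x c = 0" "?S = 0"
    using Suc.prems(1) \<open>a > 0\<close> by (auto simp: kernel_form_Suc add_nonneg_eq_0_iff)
  have zero_k: "kernel_form a p x (\<lambda>i. c i * x i $ k) = 0" for k
    using zero(2) \<open>a > 0\<close> by (subst (asm) sum_nonneg_eq_0_iff) (auto simp: kernel_form_nonneg)
  show ?case
  proof (cases "sum \<alpha> UNIV \<le> p")
    case True
    then show ?thesis using Suc.IH zero(1) by blast
  next
    case False
    then have "sum \<alpha> UNIV \<noteq> 0" by linarith
    then obtain k where k: "\<alpha> k > 0" by auto
    define \<beta> where "\<beta> = \<alpha>(k := \<alpha> k - 1)"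
    have \<alpha>: "\<alpha> = (\<lambda>j. of_bool (j = k) + \<beta> j)"
      using k by (auto simp: \<beta>_def)
    have "sum \<alpha> UNIV = Suc (sum \<beta> UNIV)"
      by (subst \<alpha>) (simp add: sum.distrib of_bool_def)
    then have "(\<Sum>i\<in>UNIV. c i * x i $ k * monomial_fun \<beta> (x i)) = 0"
      using Suc zero_k by simp
    moreover have "monomial_fun \<alpha> y = y $ k * monomial_fun \<beta> y" for y :: "real ^ 'd"
      using fun_cong[OF monomial_fun_mult[of "\<lambda>j. of_bool (j = k)" \<beta>], of y]
      by (simp add: monomial_fun_unit flip: \<alpha>)
    ultimately show ?thesis by (simp add: mult.assoc)
  qed
qed

lemma kernel_form_eq_0_poly_space:
  assumes "a > 0" and "kernel_form a p x c = 0" and "u \<in> poly_space p"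
  shows "(\<Sum>i\<in>UNIV. c i * u (x i)) = 0"
  using assms(3)
proof (induction u rule: poly_space_induct)
  case zero
  then show ?case by simp
next
  case (add b \<alpha> v)
  have "(\<Sum>i\<in>UNIV. c i * (scale_fun b (monomial_fun \<alpha>) + v) (x i))
      = b * (\<Sum>i\<in>UNIV. c i * monomial_fun \<alpha> (x i)) + (\<Sum>i\<in>UNIV. c i * v (x i))"
    by (simp add: scale_fun_def algebra_simps sum.distrib sum_distrib_left)
  then show ?case using add kernel_form_eq_0_monomial[OF assms(1,2)] by simp
qed

lemma invertible_kernel_matrix:
  fixes x :: "'n::finite \<Rightarrow> real ^ 'd::finite"
  assumes "a > 0" and "inj x" and "nodal (poly_space p) (range x)"
  shows "invertible (kernel_matrix (poly_kernel a p) x)"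
proof -
  let ?K = "kernel_matrix (poly_kernel a p) x"
  obtain l where l: "\<And>y. y \<in> range x \<Longrightarrow> l y \<in> poly_space p"
      "\<And>y z. y \<in> range x \<Longrightarrow> z \<in> range x \<Longrightarrow> l y z = of_bool (z = y)"
    using assms(3) unfolding nodal_def by blast
  have "v = 0" if "?K *v v = 0" for v
  proof -
    have "kernel_form a p x (\<lambda>i. v $ i) = v \<bullet> (?K *v v)"
      by (simp add: kernel_form_def kernel_matrix_def inner_vec_def matrix_vector_mult_def
          sum_distrib_left ac_simps)
    then have form: "kernel_form a p x (\<lambda>i. v $ i) = 0" using that by simp
    have "v $ j = 0" for j
    proof -
      have "0 = (\<Sum>i\<in>UNIV. v $ i * l (x j) (x i))"
        using kernel_form_eq_0_poly_space[OF assms(1) form l(1)] by simp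
      also have "\<dots> = (\<Sum>i\<in>UNIV. if i = j then v $ i else 0)"
        by (rule sum.cong) (use l(2) assms(2) in \<open>auto simp: inj_eq\<close>)
      finally show ?thesis by simp
    qed
    then show ?thesis by (simp add: vec_eq_iff)
  qed
  then show ?thesis
    unfolding invertible_left_inverse matrix_left_invertible_ker by blast
qed

theorem theorem8:
  fixes \<Omega> :: "(real ^ 'd::finite) set"
    and a :: real
    and x :: "'n::finite \<Rightarrow> real ^ 'd"
    and p :: nat
  assumes "a > 0"
    and "inj x"
    and "range x \<subseteq> \<Omega>"
    and "p \<ge> CARD('d) * (CARD('n) - 1)"
  shows "(\<exists>Y :: (real ^ 'd) set.
            finite Y \<and> card Y = (CARD('d) + p) choose CARD('d) \<and>
            range x \<subseteq> Y \<and> unisolvent (poly_space p) Y)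
       \<and> invertible (kernel_matrix (poly_kernel a p) x)"
proof -
  have "CARD('n) - 1 \<le> CARD('d) * (CARD('n) - 1)" by simp
  then have "card (range x) - 1 \<le> p"
    unfolding card_image[OF assms(2)] using assms(4) by (rule order_trans)
  then have nodal: "nodal (poly_space p) (range x)"
    by (intro nodal_poly_space) auto
  obtain Y where "range x \<subseteq> Y" "unisolvent (poly_space p) Y"
    by (rule nodal_extends_to_unisolvent[OF subspace_poly_space finite_monomials[of p] _ _ nodal])
      (auto simp: poly_space_def)
  moreover from this have "finite Y" "card Y = (CARD('d) + p) choose CARD('d)"
    by (auto simp: unisolvent_def dim_poly_space)
  ultimately show ?thesis
    using invertible_kernel_matrix[OF assms(1,2) nodal] by blast
qed

end
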